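(* The number of $4\times 4$ Hadamard matrices $\mathrm{Hada}(a_1,a_2,a_3,a_4)$ over $\mathbb{F}_{2^r}$, with exactly one of $a_1,a_2,a_3,a_4$ equal to $0$, that are both involutory and NMDS is $$4(2^{2r}-3\cdot 2^r+3).$$
   Context: For $a_1,a_2,a_3,a_4\in\mathbb{F}_{2^r}$, $\mathrm{Hada}(a_1,a_2,a_3,a_4)$ denotes the (finite field) Hadamard matrix $$\begin{bmatrix} a_1&a_2&a_3&a_4\\ a_2&a_1&a_4&a_3\\ a_3&a_4&a_1&a_2\\ a_4&a_3&a_2&a_1\end{bmatrix}.$$ An $n\times n$ matrix $M$ is involutory if $M^2=I_n$. An $[m,k]$ linear code is Near-MDS (NMDS) if its minimum distance is $m-k$ and its dual $[m,m-k]$ code has minimum distance $k$. A matrix $M$ of order $N$ is an NMDS matrix if $[I_N\,|\,M]$ is a generator matrix of a $[2N,N]$ NMDS code (i.e. the code and its dual both have minimum distance $N$). *)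

theory Defs
  imports "HOL-Analysis.Cartesian_Space"
begin

definition linear_code :: "nat \<Rightarrow> nat \<Rightarrow> ('a::field ^ 'm) set \<Rightarrow> bool" where
  "linear_code m k C \<longleftrightarrow> CARD('m) = m \<and> vec.subspace C \<and> vec.dim C = k"

definition hamming_dist :: "'a ^ 'm \<Rightarrow> 'a ^ 'm \<Rightarrow> nat" where
  "hamming_dist u v = card {i. u $ i \<noteq> v $ i}"

text \<open>\<^const>\<open>Inf\<close> on \<^typ>\<open>nat\<close> is the least element of a nonempty set;
  a code with fewer than two words gets the value 0.\<close>

definition min_distance :: "('a ^ 'm) set \<Rightarrow> nat" where
  "min_distance C = Inf {hamming_dist u v | u v. u \<in> C \<and> v \<in> C \<and> u \<noteq> v}"

definition dual_code :: "('a::field ^ 'm) set \<Rightarrow> ('a ^ 'm) set" where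
  "dual_code C = {v. \<forall>u\<in>C. (\<Sum>i\<in>UNIV. u $ i * v $ i) = 0}"

text \<open>The subtraction does not truncate: \<^term>\<open>linear_code m k C\<close> implies \<^term>\<open>k \<le> m\<close>.\<close>

definition nmds_code :: "nat \<Rightarrow> nat \<Rightarrow> ('a::field ^ 'm) set \<Rightarrow> bool" where
  "nmds_code m k C \<longleftrightarrow>
     linear_code m k C \<and> min_distance C = m - k \<and>
     linear_code m (m - k) (dual_code C) \<and> min_distance (dual_code C) = k"

text \<open>Since \<^const>\<open>rows\<close> is a set, injectivity is needed to exclude repeated rows.\<close>

definition generator_matrix :: "'a::field ^ 'm ^ 'k \<Rightarrow> ('a ^ 'm) set \<Rightarrow> bool" where
  "generator_matrix G C \<longleftrightarrow>
     inj (\<lambda>i. row i G) \<and> vec.independent (rows G) \<and> vec.span (rows G) = C"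

text \<open>The block matrix \<open>[I | M]\<close>: columns \<^term>\<open>Inl j\<close> are those of the identity,
  columns \<^term>\<open>Inr j\<close> those of \<open>M\<close>.\<close>

definition identity_augmented :: "'a::field ^ 'n ^ 'n \<Rightarrow> 'a ^ ('n + 'n) ^ 'n" where
  "identity_augmented M =
     (\<chi> i c. case c of Inl j \<Rightarrow> (mat 1 :: 'a ^ 'n ^ 'n) $ i $ j | Inr j \<Rightarrow> M $ i $ j)"

definition nmds_matrix :: "'a::field ^ 'n ^ 'n \<Rightarrow> bool" where
  "nmds_matrix M \<longleftrightarrow>
     (\<exists>C. nmds_code (2 * CARD('n)) CARD('n) C \<and> generator_matrix (identity_augmented M) C)"

definition involutory :: "'a::field ^ 'n ^ 'n \<Rightarrow> bool" where
  "involutory M \<longleftrightarrow> M ** M = mat 1"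

definition Hada :: "'a::field \<Rightarrow> 'a \<Rightarrow> 'a \<Rightarrow> 'a \<Rightarrow> 'a ^ 4 ^ 4" where
  "Hada a1 a2 a3 a4 = vector
     [vector [a1, a2, a3, a4],
      vector [a2, a1, a4, a3],
      vector [a3, a4, a1, a2],
      vector [a4, a3, a2, a1]]"

end

theory Submission
  imports Defs
begin

text \<open>The square of \<open>Hada(a\<^sub>1, a\<^sub>2, a\<^sub>3, a\<^sub>4)\<close> is the scalar matrix
  \<open>(a\<^sub>1 + a\<^sub>2 + a\<^sub>3 + a\<^sub>4)\<^sup>2\<close> in characteristic 2, so such a matrix is involutory iff its
  entries sum to 1. In that case the code \<open>{(x, M x)}\<close> generated by \<open>[I | M]\<close> is self-dual, because
  \<open>M\<close> is symmetric and \<open>-1 = 1\<close>. A nonzero codeword of weight below 4 would have \<open>x\<close> or \<open>M x\<close> of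
  weight 1; since \<open>x = M (M x)\<close>, the other half is then a multiple of a row of \<open>M\<close>, which has weight
  3 when exactly one of the entries is 0. So the NMDS condition is automatic, and it remains to count
  the nonzero solutions of \<open>a + b + c = 1\<close>.\<close>

section \<open>Characteristic 2 and the count of triples\<close>

lemma two_eq_zero_of_card:
  assumes "CARD('a::{field, finite}) = 2 ^ r"
  shows "(2::'a) = 0"
proof -
  \<comment> \<open>Translation by 1 permutes the field. Splitting the left sum therefore leaves
    \<open>CARD('a)\<close> times 1 equal to 0, that is \<open>2 ^ r = 0\<close>, and a field has no
    nonzero nilpotents.\<close>
  have "(\<Sum>x\<in>UNIV. x + 1) = (\<Sum>x\<in>(UNIV::'a set). x)"
    by (rule sum.reindex_bij_witness[where i = "\<lambda>x. x - 1" and j = "\<lambda>x. x + 1"]) auto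
  then have "of_nat CARD('a) = (0::'a)"
    by (simp add: sum.distrib)
  then show ?thesis
    using assms by simp
qed

lemma card_Collect_neq_0_neq_1:
  "card {a::'a::{field, finite}. a \<noteq> 0 \<and> a \<noteq> 1} = CARD('a) - 2"
proof -
  have "{a::'a. a \<noteq> 0 \<and> a \<noteq> 1} = UNIV - {0, 1}"
    by auto
  then show ?thesis
    by (simp add: card_Diff_subset)
qed

text \<open>The pair \<open>(a, b)\<close> determines \<open>c = 1 - a - b\<close>. Among the pairs
  in \<open>?U\<close>, those with \<open>c = 0\<close> form \<open>?L\<close>: here
  \<open>b = 1 - a\<close> with \<open>a\<close> neither 0 nor 1. With q field elements this leaves
  (q - 1)^2 - (q - 2) triples.\<close>

lemma card_triples_nonzero_sum_1:
  "int (card {(a, b, c :: 'a::{field, finite}). a \<noteq> 0 \<and> b \<noteq> 0 \<and> c \<noteq> 0 \<and> a + b + c = 1})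
   = int CARD('a) ^ 2 - 3 * int CARD('a) + 3" (is "int (card ?T) = _")
proof -
  let ?D = "{a::'a. a \<noteq> 0 \<and> 1 - a \<noteq> 0}"
  let ?U = "(UNIV - {0::'a}) \<times> (UNIV - {0::'a})"
  let ?L = "(\<lambda>a. (a, 1 - a)) ` ?D"
  have "card ?T = card (?U - ?L)"
    by (rule bij_betw_same_card[of "\<lambda>(a, b, c). (a, b)"],
        rule bij_betw_byWitness[where f' = "\<lambda>(a, b). (a, b, 1 - a - b)"])
       (auto simp: algebra_simps)
  also have "int \<dots> = int (card ?U) - int (card ?L)"
  proof -
    have sub: "?L \<subseteq> ?U"
      by auto
    have "card ?L \<le> card ?U"
      by (rule card_mono[OF _ sub]) simp
    moreover have "card (?U - ?L) = card ?U - card ?L"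
      by (rule card_Diff_subset[OF _ sub]) simp
    ultimately show ?thesis
      by simp
  qed
  also have "card ?L = CARD('a) - 2"
    by (simp add: card_image inj_on_def card_Collect_neq_0_neq_1)
  also have "card ?U = (CARD('a) - 1) * (CARD('a) - 1)"
    by (simp add: card_cartesian_product card_Diff_subset)
  finally have *: "int (card ?T) = int ((CARD('a) - 1) * (CARD('a) - 1)) - int (CARD('a) - 2)" .
  \<comment> \<open>Two distinct elements exist, so neither subtraction on naturals
    truncates.\<close>
  have "card {0, 1::'a} \<le> CARD('a)"
    by (rule card_mono) auto
  then have "2 \<le> CARD('a)"
    by simp
  then obtain k where "CARD('a) = k + 2"
    by (metis add.commute le_Suc_ex)
  then show ?thesis
    unfolding * by (simp add: power2_eq_square algebra_simps)
qed

section \<open>Hamming weight and minimum distance\<close>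

lemma hamming_dist_eq_sum:
  "hamming_dist u v = (\<Sum>i\<in>UNIV. if u $ i \<noteq> v $ i then 1 else 0)"
  by (simp add: hamming_dist_def sum.If_cases)

lemma hamming_dist_diff:
  fixes u v :: "'a::field ^ 'm"
  shows "hamming_dist u v = hamming_dist (u - v) 0"
  by (simp add: hamming_dist_def)

lemma hamming_dist_pos:
  "u \<noteq> v \<Longrightarrow> 0 < hamming_dist u v"
  by (auto simp: hamming_dist_def vec_eq_iff card_gt_0_iff)

lemma hamming_dist_scale:
  fixes v :: "'a::field ^ 'm"
  shows "c \<noteq> 0 \<Longrightarrow> hamming_dist (c *s v) 0 = hamming_dist v 0"
  by (simp add: hamming_dist_def)

lemma hamming_weight_1_cases:
  fixes v :: "'a::field ^ 'm"
  assumes "hamming_dist v 0 = 1"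
  obtains c i where "c \<noteq> 0" "v = c *s axis i 1"
proof -
  obtain i where i: "{i. v $ i \<noteq> 0} = {i}"
    using assms by (auto simp: hamming_dist_def card_1_singleton_iff)
  then have "v $ i \<noteq> 0" "\<And>j. j \<noteq> i \<Longrightarrow> v $ j = 0"
    by auto
  then have "v = v $ i *s axis i 1"
    by (auto simp: vec_eq_iff axis_def)
  with \<open>v $ i \<noteq> 0\<close> show ?thesis
    by (rule that)
qed

text \<open>Differences of codewords are codewords, so the distances between distinct codewords are
  exactly the weights of nonzero ones.\<close>

lemma min_distance_eqI:
  assumes "vec.subspace C"
    and lower: "\<And>v. v \<in> C \<Longrightarrow> v \<noteq> 0 \<Longrightarrow> d \<le> hamming_dist v 0"
    and w: "w \<in> C" "w \<noteq> 0" "hamming_dist w 0 = d"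
  shows "min_distance C = d"
  unfolding min_distance_def
proof (rule cInf_eq_minimum)
  show "d \<in> {hamming_dist u v |u v. u \<in> C \<and> v \<in> C \<and> u \<noteq> v}"
    using w vec.subspace_0[OF assms(1)] by blast
next
  fix n
  assume "n \<in> {hamming_dist u v |u v. u \<in> C \<and> v \<in> C \<and> u \<noteq> v}"
  then obtain u v where "u \<in> C" "v \<in> C" "u \<noteq> v" "n = hamming_dist (u - v) 0"
    using hamming_dist_diff by blast
  then show "d \<le> n"
    using lower[of "u - v"] vec.subspace_diff[OF assms(1)] by simp
qed

section \<open>The code generated by \<open>[I | M]\<close> and its dual\<close>

definition encode :: "'a::field ^ 'n ^ 'n \<Rightarrow> 'a ^ 'n \<Rightarrow> 'a ^ ('n + 'n)" where
  "encode M x = transpose (identity_augmented M) *v x"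

lemma encode_Inl [simp]: "encode M x $ Inl j = x $ j"
  by (simp add: encode_def identity_augmented_def transpose_def matrix_vector_mult_def mat_def
      if_distrib[of "\<lambda>y. y * _"] cong: if_cong)

text \<open>\<open>encode M x\<close> combines the rows of \<open>[I | M]\<close> with coefficients
  \<open>x\<close>; as a product with a column vector this puts a transpose on
  \<open>M\<close>.\<close>

lemma encode_Inr [simp]: "encode M x $ Inr j = (transpose M *v x) $ j"
  by (simp add: encode_def identity_augmented_def transpose_def matrix_vector_mult_def)

lemma linear_encode: "Vector_Spaces.linear (*s) (*s) (encode M)"
  unfolding encode_def by (rule matrix_vector_mul_linear_gen)

lemma inj_encode: "inj (encode M)"
  by (rule injI) (metis encode_Inl vec_eq_iff)

lemma matrix_vector_mult_axis: "A *v axis i 1 = column i A"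
  by (simp add: matrix_vector_mult_def column_def axis_def if_distrib[of "\<lambda>y. _ * y"] cong: if_cong)

lemma row_identity_augmented: "row i (identity_augmented M) = encode M (axis i 1)"
  by (simp add: encode_def matrix_vector_mult_axis column_transpose del: transpose_matrix_vector)

lemma rows_identity_augmented: "rows (identity_augmented M) = encode M ` cart_basis"
  by (auto simp: rows_def row_identity_augmented cart_basis_def)

text \<open>The rows are the images of the standard basis under the injective linear map
  \<open>encode M\<close>, which carries over both independence and span.\<close>

lemma generator_matrix_identity_augmented:
  "generator_matrix (identity_augmented M) (range (encode M))"
proof -
  interpret E: Vector_Spaces.linear "(*s)" "(*s)" "encode M"
    by (rule linear_encode)
  have "inj (\<lambda>i. row i (identity_augmented M))"
    unfolding row_identity_augmented
    by (rule injI) (simp add: inj_eq[OF inj_encode] axis_eq_axis)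
  moreover have "vec.independent (rows (identity_augmented M))"
    unfolding rows_identity_augmented
    by (rule E.independent_injective_image[OF independent_cart_basis])
       (rule inj_on_subset[OF inj_encode subset_UNIV])
  moreover have "vec.span (rows (identity_augmented M)) = range (encode M)"
    unfolding rows_identity_augmented by (simp add: E.span_image)
  ultimately show ?thesis
    unfolding generator_matrix_def by blast
qed

lemma linear_code_range_encode:
  fixes M :: "'a::field ^ 'n ^ 'n"
  shows "linear_code (2 * CARD('n)) CARD('n) (range (encode M))"
proof -
  interpret E: Vector_Spaces.linear "(*s)" "(*s)" "encode M"
    by (rule linear_encode)
  have "vec.subspace (range (encode M))"
    by (rule E.subspace_image) (rule vec.subspace_UNIV)
  moreover have "vec.dim (range (encode M)) = CARD('n)"
    using vec.dim_image_eq[OF linear_encode, of M UNIV] inj_encode[of M]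
    by (simp add: card_cart_basis)
  ultimately show ?thesis
    by (simp add: linear_code_def)
qed

lemma sum_UNIV_Plus:
  fixes f :: "'a::finite + 'b::finite \<Rightarrow> 'c::comm_monoid_add"
  shows "sum f UNIV = (\<Sum>i\<in>UNIV. f (Inl i)) + (\<Sum>i\<in>UNIV. f (Inr i))"
  by (simp add: UNIV_Plus_UNIV[symmetric] sum.Plus del: UNIV_Plus_UNIV)

lemma hamming_dist_encode:
  "hamming_dist (encode M x) 0 = hamming_dist x 0 + hamming_dist (transpose M *v x) 0"
  by (simp add: hamming_dist_eq_sum sum_UNIV_Plus)

text \<open>A word \<open>(x, w)\<close> is orthogonal to every \<open>(y, transpose M *v y)\<close>
  iff \<open>x + M *v w = 0\<close>. As \<open>- transpose M\<close> inverts \<open>M\<close>, this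
  says \<open>w = transpose M *v x\<close>, which describes the code itself.\<close>

lemma dual_code_range_encode:
  fixes M :: "'a::field ^ 'n ^ 'n"
  assumes "M ** transpose M = - mat 1"
  shows "dual_code (range (encode M)) = range (encode M)"
proof -
  define M' where "M' = - transpose M"
  have "M ** M' = mat 1"
    using assms unfolding M'_def by (simp add: matrix_matrix_mult_def vec_eq_iff sum_negf)
  then have inv: "M' ** M = mat 1"
    using matrix_left_right_inverse by blast
  have M'_mult: "M' *v x = - (transpose M *v x)" for x
    by (simp add: M'_def matrix_vector_mult_def vec_eq_iff sum_negf)
  \<comment> \<open>Moving \<open>transpose M\<close> to the other side of the pairing collects the
    coefficient of each \<open>x $ i\<close>.\<close>
  have prod: "(\<Sum>k\<in>UNIV. encode M x $ k * v $ k)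
      = (\<Sum>i\<in>UNIV. x $ i * (v $ Inl i + (M *v (\<chi> j. v $ Inr j)) $ i))" for x v
  proof -
    have "(\<Sum>j\<in>UNIV. (transpose M *v x) $ j * v $ Inr j)
        = (\<Sum>j\<in>UNIV. \<Sum>i\<in>UNIV. x $ i * (M $ i $ j * v $ Inr j))"
      by (simp add: matrix_vector_mult_def transpose_def sum_distrib_left sum_distrib_right mult_ac)
    also have "\<dots> = (\<Sum>i\<in>UNIV. x $ i * (M *v (\<chi> j. v $ Inr j)) $ i)"
      by (subst sum.swap) (simp add: matrix_vector_mult_def sum_distrib_left)
    finally show ?thesis
      by (simp add: sum_UNIV_Plus distrib_left sum.distrib)
  qed
  have dual: "v \<in> dual_code (range (encode M)) \<longleftrightarrow>
      (\<forall>i. v $ Inl i + (M *v (\<chi> j. v $ Inr j)) $ i = 0)" (is "_ \<longleftrightarrow> ?R") for v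
  proof
    assume v: "v \<in> dual_code (range (encode M))"
    show ?R
    proof
      fix i
      \<comment> \<open>Pairing with the codeword of a unit vector isolates one coefficient.\<close>
      have "0 = (\<Sum>k\<in>UNIV. encode M (axis i 1) $ k * v $ k)"
        using v by (simp add: dual_code_def)
      then show "v $ Inl i + (M *v (\<chi> j. v $ Inr j)) $ i = 0"
        unfolding prod by (simp add: axis_def if_distrib[of "\<lambda>y. y * _"] cong: if_cong)
    qed
  next
    assume ?R
    then show "v \<in> dual_code (range (encode M))"
      by (auto simp: dual_code_def prod)
  qed
  show ?thesis
  proof (intro equalityI subsetI)
    fix v
    assume "v \<in> dual_code (range (encode M))"
    define x w where "x = (\<chi> i. v $ Inl i)" and "w = (\<chi> j. v $ Inr j)"
    have "M *v w = - x"
      using \<open>v \<in> _\<close> unfolding dual by (simp add: vec_eq_iff x_def w_def eq_neg_iff_add_eq_0 add.commute)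
    then have "w = M' *v (- x)"
      by (metis inv matrix_vector_mul_assoc matrix_vector_mul_lid)
    also have "\<dots> = transpose M *v x"
      by (simp add: M'_mult vec.neg)
    finally have "v $ k = encode M x $ k" for k
      by (cases k) (auto simp: x_def w_def vec_eq_iff)
    then show "v \<in> range (encode M)"
      by (metis rangeI vec_eq_iff)
  next
    fix v
    assume "v \<in> range (encode M)"
    then obtain x where v: "v = encode M x"
      by blast
    have "M *v (transpose M *v x) = - x"
      by (metis M'_mult \<open>M ** M' = mat 1\<close> matrix_vector_mul_assoc matrix_vector_mul_lid vec.neg
          minus_equation_iff)
    then show "v \<in> dual_code (range (encode M))"
      by (simp add: dual v)
  qed
qed

section \<open>A sufficient condition for NMDS\<close>

lemma nmds_matrix_of_row_weight_3:
  fixes M :: "'a::field ^ 4 ^ 4"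
  assumes sym: "transpose M = M" and invol: "M ** M = mat 1" and "(2::'a) = 0"
    and row_weight: "\<And>i. hamming_dist (row i M) 0 = 3"
  shows "nmds_matrix M"
proof -
  let ?C = "range (encode M)"
  have neg: "- a = a" for a :: 'a
    using \<open>2 = 0\<close> by (metis mult_2 mult_zero_left neg_eq_iff_add_eq_0)
  then have "M ** transpose M = - mat 1"
    by (simp add: sym invol vec_eq_iff)
  then have dual: "dual_code ?C = ?C"
    by (rule dual_code_range_encode)
  have code: "linear_code 8 4 ?C"
    using linear_code_range_encode[of M] by simp
  have MM: "M *v (M *v x) = x" for x
    by (simp add: matrix_vector_mul_assoc invol)
  have weight_mult: "hamming_dist (M *v x) 0 = 3" if x: "hamming_dist x 0 = 1" for x
  proof -
    obtain c i where "c \<noteq> 0" "x = c *s axis i 1"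
      using hamming_weight_1_cases[OF x] by blast
    moreover have "M *v axis i 1 = row i M"
      by (metis sym matrix_vector_mult_axis column_transpose)
    ultimately show ?thesis
      using row_weight[of i] by (simp add: vec.scale hamming_dist_scale)
  qed
  have weight: "hamming_dist (encode M x) 0 = hamming_dist x 0 + hamming_dist (M *v x) 0" for x
    by (simp add: hamming_dist_encode sym)
  \<comment> \<open>By self-duality this single value settles both distance conditions.\<close>
  have "min_distance ?C = 4"
  proof (rule min_distance_eqI)
    show "vec.subspace ?C"
      using code by (simp add: linear_code_def)
  next
    fix v
    assume "v \<in> ?C" "v \<noteq> 0"
    then obtain x where v: "v = encode M x"
      by blast
    have "x \<noteq> 0"
      using v \<open>v \<noteq> 0\<close> by (auto simp: encode_def)
    moreover from this have "M *v x \<noteq> 0"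
      using MM[of x] by auto
    ultimately have pos: "0 < hamming_dist x 0" "0 < hamming_dist (M *v x) 0"
      by (simp_all add: hamming_dist_pos)
    \<comment> \<open>Both halves have positive weight. If either weight is 1, the other is 3;
      otherwise both are at least 2.\<close>
    show "4 \<le> hamming_dist v 0"
      using weight_mult[of x] weight_mult[of "M *v x"] pos unfolding v weight MM by linarith
  next
    \<comment> \<open>The first row of \<open>[I | M]\<close> attains the bound, with weight 1 +
      3.\<close>
    show "encode M (axis 1 1) \<in> ?C"
      by simp
  next
    have "hamming_dist (axis 1 1 :: 'a ^ 4) 0 = 1"
      by (simp add: hamming_dist_def axis_def)
    then show *: "hamming_dist (encode M (axis 1 1)) 0 = 4"
      by (simp add: weight weight_mult)
    show "encode M (axis 1 1) \<noteq> 0"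
      using * by (auto simp: hamming_dist_def)
  qed
  then have "nmds_code 8 4 ?C"
    using code by (simp add: nmds_code_def dual)
  then show ?thesis
    using generator_matrix_identity_augmented[of M] by (auto simp: nmds_matrix_def)
qed

section \<open>Hadamard matrices in characteristic 2\<close>

lemma vector_4 [simp]:
  "(vector [x, y, z, w] :: 'a::zero ^ 4) $ 1 = x"
  "(vector [x, y, z, w] :: 'a::zero ^ 4) $ 2 = y"
  "(vector [x, y, z, w] :: 'a::zero ^ 4) $ 3 = z"
  "(vector [x, y, z, w] :: 'a::zero ^ 4) $ 4 = w"
  unfolding vector_def by simp_all

lemma transpose_Hada: "transpose (Hada a b c d) = Hada a b c d"
  by (simp add: Hada_def transpose_def vec_eq_iff forall_4)

lemma Hada_eq_iff:
  "Hada a b c d = Hada a' b' c' d' \<longleftrightarrow> a = a' \<and> b = b' \<and> c = c' \<and> d = d'"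
  by (auto simp: Hada_def vec_eq_iff forall_4)

lemma involutory_Hada_iff:
  fixes a b c d :: "'a::field"
  assumes "(2::'a) = 0"
  shows "involutory (Hada a b c d) \<longleftrightarrow> a + b + c + d = 1"
proof -
  have two: "2 * x = 0" for x :: 'a
    by (simp only: assms mult_zero_left)
  \<comment> \<open>The two sides differ by twice the sum of all products of two distinct
    variables.\<close>
  have diag: "x * x + y * y + z * z + w * w = (x + y + z + w)\<^sup>2" for x y z w :: 'a
    using two[of "x * y + x * z + x * w + y * z + y * w + z * w"] by algebra
  \<comment> \<open>Each diagonal entry of the square is a sum as in \<open>diag\<close>. In an
    off-diagonal entry every product occurs twice, so the entry vanishes.\<close>
  have "involutory (Hada a b c d) \<longleftrightarrow> (a + b + c + d)\<^sup>2 = 1"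
    by (simp add: involutory_def matrix_matrix_mult_def mat_def Hada_def vec_eq_iff forall_4 sum_4
        diag) (auto simp: add_ac two)
  also have "\<dots> \<longleftrightarrow> (a + b + c + d - 1)\<^sup>2 = 0"
  proof -
    \<comment> \<open>Squaring is additive in characteristic 2, so 1 is the only square root of
      1.\<close>
    have "(a + b + c + d - 1)\<^sup>2 = (a + b + c + d)\<^sup>2 - 1"
      using two[of "a + b + c + d - 1"] by algebra
    then show ?thesis
      by simp
  qed
  finally show ?thesis
    by simp
qed

text \<open>Every row is a permutation of the four entries, so it contains exactly one zero.\<close>

lemma hamming_dist_row_Hada:
  assumes "count_list [a, b, c, d] 0 = 1"
  shows "hamming_dist (row i (Hada a b c d)) 0 = 3"
proof -
  have "\<forall>i. hamming_dist (row i (Hada a b c d)) 0 = 3"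
    using assms
    by (auto simp: forall_4 hamming_dist_eq_sum sum_4 row_def Hada_def split: if_splits)
  then show ?thesis ..
qed

section \<open>The count of matrices\<close>

theorem corollary4:
  fixes r :: nat
  assumes "CARD('a::{field, finite}) = 2 ^ r"
  shows "int (card {M :: 'a ^ 4 ^ 4. \<exists>a1 a2 a3 a4.
            M = Hada a1 a2 a3 a4 \<and> count_list [a1, a2, a3, a4] 0 = 1 \<and>
            involutory M \<and> nmds_matrix M})
         = 4 * (2 ^ (2 * r) - 3 * 2 ^ r + 3)"
    (is "int (card ?A) = _")
proof -
  let ?T = "{(a, b, c :: 'a). a \<noteq> 0 \<and> b \<noteq> 0 \<and> c \<noteq> 0 \<and> a + b + c = 1}"
  \<comment> \<open>\<open>?H\<close> inserts a zero at position \<open>k\<close>, counted from 0,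
    into a triple of nonzero entries.\<close>
  let ?H = "\<lambda>p. case p of (k :: nat, a, b, c) \<Rightarrow>
    if k = 0 then Hada 0 a b c else if k = 1 then Hada a 0 b c
    else if k = 2 then Hada a b 0 c else Hada a b c (0::'a)"
  have two: "(2::'a) = 0"
    using assms by (rule two_eq_zero_of_card)
  have nmds: "nmds_matrix (Hada a b c d)"
    if "count_list [a, b, c, d] 0 = 1" "involutory (Hada a b c d)" for a b c d :: 'a
    using that two
    by (intro nmds_matrix_of_row_weight_3 transpose_Hada hamming_dist_row_Hada)
       (simp_all add: involutory_def)
  have "?A = {M. \<exists>a b c d. M = Hada a b c d \<and> count_list [a, b, c, d] 0 = 1 \<and> a + b + c + d = 1}"
    using nmds involutory_Hada_iff[OF two] by blast
  also have "\<dots> = ?H ` ({..<4} \<times> ?T)"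
  proof (intro equalityI subsetI)
    fix M :: "'a ^ 4 ^ 4"
    assume "M \<in> {M. \<exists>a b c d. M = Hada a b c d \<and> count_list [a, b, c, d] 0 = 1 \<and> a + b + c + d = 1}"
    then obtain a b c d where M: "M = Hada a b c d" "count_list [a, b, c, d] 0 = 1" "a + b + c + d = 1"
      by blast
    then consider "a = 0" "(b, c, d) \<in> ?T" | "b = 0" "(a, c, d) \<in> ?T"
      | "c = 0" "(a, b, d) \<in> ?T" | "d = 0" "(a, b, c) \<in> ?T"
      by (auto split: if_splits)
    then show "M \<in> ?H ` ({..<4} \<times> ?T)"
    proof cases
      case 1
      then show ?thesis using M by (intro image_eqI[of _ _ "(0, b, c, d)"]) auto
    next
      case 2
      then show ?thesis using M by (intro image_eqI[of _ _ "(1, a, c, d)"]) auto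
    next
      case 3
      then show ?thesis using M by (intro image_eqI[of _ _ "(2, a, b, d)"]) auto
    next
      case 4
      then show ?thesis using M by (intro image_eqI[of _ _ "(3, a, b, c)"]) auto
    qed
  next
    fix M
    assume "M \<in> ?H ` ({..<4} \<times> ?T)"
    then obtain k a b c where "M = ?H (k, a, b, c)" "(a, b, c) \<in> ?T"
      by blast
    then show "M \<in> {M. \<exists>a b c d. M = Hada a b c d \<and> count_list [a, b, c, d] 0 = 1 \<and> a + b + c + d = 1}"
      by (auto simp: Hada_eq_iff)
  qed
  finally have "card ?A = card (?H ` ({..<4} \<times> ?T))"
    by simp
  also have "\<dots> = card ({..<4::nat} \<times> ?T)"
    \<comment> \<open>The matrix determines its four entries. As the triple has no zero, the place
      of the zero entry determines \<open>k\<close>, and the remaining entries give back the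
      triple.\<close>
    by (rule card_image) (auto simp: inj_on_def Hada_eq_iff split: if_splits)
  finally have "int (card ?A) = 4 * int (card ?T)"
    by (simp add: card_cartesian_product)
  then show ?thesis
    unfolding card_triples_nonzero_sum_1 assms by (simp add: power_mult[symmetric] mult.commute)
qed

end
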